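(* Let $\Sigma_0,\mathcal{R}_0$ be a confluent system and $\Sigma_1,\mathcal{R}_1$ a fragment of $\Sigma_0,\mathcal{R}_0$ that preserves typing. Then: (1) If $\Gamma\vdash_{\Sigma_0,\mathcal{R}_0} t:D$ is derivable, $\Gamma\in\Lambda(\Sigma_1)$ and $t\in\Lambda(\Sigma_1)$, then there exists $D'\in\Lambda(\Sigma_1)$ such that $D\hookrightarrow_{\beta\mathcal{R}_0}^* D'$ and $\Gamma\vdash_{\Sigma_1,\mathcal{R}_1} t:D'$ is derivable. (2) If $\vdash_{\Sigma_0,\mathcal{R}_0}\Gamma$ well-formed is derivable and $\Gamma\in\Lambda(\Sigma_1)$, then $\vdash_{\Sigma_1,\mathcal{R}_1}\Gamma$ well-formed is derivable.
   Context: $\lambda\Pi$-calculus modulo theory. Terms: $t,u ::= c \mid x \mid \mathtt{TYPE} \mid \mathtt{KIND} \mid \Pi x:t.\,u \mid \lambda x:t.\,u \mid t\,u$ ($c$ constants, $x$ variables); $\mathtt{TYPE},\mathtt{KIND}$ are sorts; $\mathrm{const}(t)$ is the set of constants of $t$. A rewriting rule is $\ell\hookrightarrow r$ with $\ell=c\,\ell_1\ldots\ell_n$, $c$ a constant. For a rule set $\mathcal{R}$, $\hookrightarrow_{\mathcal{R}}$ is the smallest relation closed under term constructors and substitution containing $\mathcal{R}$, $\hookrightarrow_{\beta\mathcal{R}}=\hookrightarrow_\beta\cup\hookrightarrow_{\mathcal{R}}$, and $\equiv_{\beta\mathcal{R}}$ the smallest equivalence containing it. A signature $\Sigma$ is a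 list $c_1:A_1,\ldots,c_n:A_n$ of constants with closed terms; $|\Sigma|=\{c_1,\ldots,c_n\}$; $\Lambda(\Sigma)=\{t:\mathrm{const}(t)\subseteq|\Sigma|\}$; a context $x_1:B_1,\ldots,x_m:B_m$ is in $\Lambda(\Sigma)$ if all $B_i$ are; a rule is in $\Lambda(\Sigma)$ if both sides are. Typing rules (with $s$ a sort): (empty) $\vdash [\,]$ well-formed; (decl) from $\Gamma\vdash A:s$ infer $\vdash\Gamma,x:A$ well-formed; (sort) from $\vdash\Gamma$ well-formed infer $\Gamma\vdash\mathtt{TYPE}:\mathtt{KIND}$; (const) from $\vdash\Gamma$ well-formed and $\vdash A:s$ (empty context) infer $\Gamma\vdash c:A$ when $c:A\in\Sigma$; (var) from $\vdash\Gamma$ well-formed infer $\Gamma\vdash x:A$ when $x:A\in\Gamma$; (prod) from $\Gamma\vdash A:\mathtt{TYPE}$ and $\Gamma,x:A\vdash B:s$ infer $\Gamma\vdash\Pi x:A.B:s$; (abs) from $\Gamma\vdash A:\mathtt{TYPE}$, $\Gamma,x:A\vdash B:s$, $\Gamma,x:A\vdash t:B$ infer $\Gamma\vdash\lambda x:A.t:\Pi x:A.B$; (app) from $\Gamma\vdash t:\Pi x:A.B$ and $\Gamma\vdash u:A$ infer $\Gamma\vdash t\,u:(u/x)B$; (conv) from $\Gamma\vdash t:A$ and $\Gamma\vdash B:s$ infer $\Gamma\vdash t:B$ when $A\equiv_{\beta\mathcal{R}}B$. All judgements are parameterized by $\Sigma,\mathcal{R}$, written $\vdash_{\Sigma,\mathcal{R}}$.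 A system is a pair $\Sigma,\mathcal{R}$ with all rules of $\mathcal{R}$ in $\Lambda(\Sigma)$; it is confluent if $\hookrightarrow_{\beta\mathcal{R}}$ is confluent on $\Lambda(\Sigma)$. A rule $\ell\hookrightarrow r$ preserves typing in $\Sigma,\mathcal{R}$ if for all contexts $\Gamma$, substitutions $\theta$ and terms $A$ in $\Lambda(\Sigma)$, $\Gamma\vdash_{\Sigma,\mathcal{R}}\theta\ell:A$ implies $\Gamma\vdash_{\Sigma,\mathcal{R}}\theta r:A$; a system $\Sigma,\mathcal{R}$ preserves typing if each of its rules does (so that, when it is confluent, $\hookrightarrow_{\beta\mathcal{R}}$ preserves typing on terms of $\Lambda(\Sigma)$). A system $\Sigma_1,\mathcal{R}_1$ is a fragment of $\Sigma_0,\mathcal{R}_0$ if each declaration of $\Sigma_1$ is one of $\Sigma_0$, $\mathcal{R}_1\subseteq\mathcal{R}_0$, $\mathrm{const}(A)\subseteq|\Sigma_1|$ for all $(c:A)\in\Sigma_1$, and every rule $\ell\hookrightarrow r\in\mathcal{R}_0$ with $\mathrm{const}(\ell)\subseteq|\Sigma_1|$ satisfies $\mathrm{const}(r)\subseteq|\Sigma_1|$ and $\ell\hookrightarrow r\in\mathcal{R}_1$.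
   Formalization: Added, since the claim fails without them: no rule of R0 has KIND in its right side unless in its left (counterexample: b:TYPE, b↪KIND, t=λx:N.TYPE); each constant is declared once in a signature; the free variables of r occur in ℓ for each rule ℓ↪r. *)

theory Defs
  imports Main
begin

text \<open>
  Terms are taken modulo renaming of bound variables, represented with de Bruijn indices:
  \<open>Pi A B\<close> and \<open>Lam A t\<close> bind index 0 in their second argument.
\<close>

datatype srt = Type | Kind

datatype (const_of: 'c) trm =
    Const 'c
  | Var nat
  | Sort srt
  | Pi "'c trm" "'c trm"
  | Lam "'c trm" "'c trm"
  | App "'c trm" "'c trm"

primrec fv :: "'c trm \<Rightarrow> nat set" where
  "fv (Const c) = {}"
| "fv (Var i) = {i}"
| "fv (Sort s) = {}"
| "fv (Pi A B) = fv A \<union> {i. Suc i \<in> fv B}"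
| "fv (Lam A t) = fv A \<union> {i. Suc i \<in> fv t}"
| "fv (App t u) = fv t \<union> fv u"

primrec sorts_of :: "'c trm \<Rightarrow> srt set" where
  "sorts_of (Const c) = {}"
| "sorts_of (Var i) = {}"
| "sorts_of (Sort s) = {s}"
| "sorts_of (Pi A B) = sorts_of A \<union> sorts_of B"
| "sorts_of (Lam A t) = sorts_of A \<union> sorts_of t"
| "sorts_of (App t u) = sorts_of t \<union> sorts_of u"

definition up_ren :: "(nat \<Rightarrow> nat) \<Rightarrow> nat \<Rightarrow> nat" where
  "up_ren \<rho> = case_nat 0 (\<lambda>i. Suc (\<rho> i))"

primrec rename :: "(nat \<Rightarrow> nat) \<Rightarrow> 'c trm \<Rightarrow> 'c trm" where
  "rename \<rho> (Const c) = Const c"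
| "rename \<rho> (Var i) = Var (\<rho> i)"
| "rename \<rho> (Sort s) = Sort s"
| "rename \<rho> (Pi A B) = Pi (rename \<rho> A) (rename (up_ren \<rho>) B)"
| "rename \<rho> (Lam A t) = Lam (rename \<rho> A) (rename (up_ren \<rho>) t)"
| "rename \<rho> (App t u) = App (rename \<rho> t) (rename \<rho> u)"

definition up :: "(nat \<Rightarrow> 'c trm) \<Rightarrow> nat \<Rightarrow> 'c trm" where
  "up \<theta> = case_nat (Var 0) (\<lambda>i. rename Suc (\<theta> i))"

primrec subst :: "(nat \<Rightarrow> 'c trm) \<Rightarrow> 'c trm \<Rightarrow> 'c trm" where
  "subst \<theta> (Const c) = Const c"
| "subst \<theta> (Var i) = \<theta> i"
| "subst \<theta> (Sort s) = Sort s"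
| "subst \<theta> (Pi A B) = Pi (subst \<theta> A) (subst (up \<theta>) B)"
| "subst \<theta> (Lam A t) = Lam (subst \<theta> A) (subst (up \<theta>) t)"
| "subst \<theta> (App t u) = App (subst \<theta> t) (subst \<theta> u)"

text \<open>\<open>inst u B\<close> is \<open>(u/x)B\<close> for the variable \<open>x\<close> bound by the innermost enclosing binder of \<open>B\<close>.\<close>

definition inst :: "'c trm \<Rightarrow> 'c trm \<Rightarrow> 'c trm" where
  "inst u B = subst (case_nat u Var) B"

type_synonym 'c rule = "'c trm \<times> 'c trm"

text \<open>
  The inclusion of free variables is the usual requirement on rewriting rules; without it, a rule
  whose two sides only use constants of \<open>\<Sigma>\<close> could rewrite a term over \<open>\<Sigma>\<close> to a term with other constants.
\<close>

definition rewrite_rule :: "'c rule \<Rightarrow> bool" where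
  "rewrite_rule = (\<lambda>(l, r). (\<exists>c ls. l = foldl App (Const c) ls) \<and> fv r \<subseteq> fv l)"

inductive beta :: "'c trm \<Rightarrow> 'c trm \<Rightarrow> bool" where
  beta_root: "beta (App (Lam A t) u) (inst u t)"
| beta_Pi1: "beta A A' \<Longrightarrow> beta (Pi A B) (Pi A' B)"
| beta_Pi2: "beta B B' \<Longrightarrow> beta (Pi A B) (Pi A B')"
| beta_Lam1: "beta A A' \<Longrightarrow> beta (Lam A t) (Lam A' t)"
| beta_Lam2: "beta t t' \<Longrightarrow> beta (Lam A t) (Lam A t')"
| beta_App1: "beta t t' \<Longrightarrow> beta (App t u) (App t' u)"
| beta_App2: "beta u u' \<Longrightarrow> beta (App t u) (App t u')"

inductive rew :: "'c rule set \<Rightarrow> 'c trm \<Rightarrow> 'c trm \<Rightarrow> bool" for R where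
  rew_rule: "(l, r) \<in> R \<Longrightarrow> rew R l r"
| rew_subst: "rew R t u \<Longrightarrow> rew R (subst \<theta> t) (subst \<theta> u)"
| rew_Pi1: "rew R A A' \<Longrightarrow> rew R (Pi A B) (Pi A' B)"
| rew_Pi2: "rew R B B' \<Longrightarrow> rew R (Pi A B) (Pi A B')"
| rew_Lam1: "rew R A A' \<Longrightarrow> rew R (Lam A t) (Lam A' t)"
| rew_Lam2: "rew R t t' \<Longrightarrow> rew R (Lam A t) (Lam A t')"
| rew_App1: "rew R t t' \<Longrightarrow> rew R (App t u) (App t' u)"
| rew_App2: "rew R u u' \<Longrightarrow> rew R (App t u) (App t u')"

definition beta_rew :: "'c rule set \<Rightarrow> 'c trm \<Rightarrow> 'c trm \<Rightarrow> bool" where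
  "beta_rew R t u \<longleftrightarrow> beta t u \<or> rew R t u"

definition conv :: "'c rule set \<Rightarrow> 'c trm \<Rightarrow> 'c trm \<Rightarrow> bool" where
  "conv R = equivclp (beta_rew R)"

type_synonym 'c signature = "('c \<times> 'c trm) list"

text \<open>A constant is declared at most once, as usual for signatures.\<close>

definition is_signature :: "'c signature \<Rightarrow> bool" where
  "is_signature \<Sigma> \<longleftrightarrow> distinct (map fst \<Sigma>) \<and> (\<forall>(c, A) \<in> set \<Sigma>. fv A = {})"

definition sig_consts :: "'c signature \<Rightarrow> 'c set" where
  "sig_consts \<Sigma> = fst ` set \<Sigma>"

definition Lambda :: "'c signature \<Rightarrow> 'c trm set" where
  "Lambda \<Sigma> = {t. const_of t \<subseteq> sig_consts \<Sigma>}"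

text \<open>
  In a context the most recently declared variable comes first, so that \<open>Var i\<close> refers to the
  \<open>i\<close>-th entry, whose type lives in the context of the later entries.
\<close>

type_synonym 'c ctx = "'c trm list"

definition ctx_in :: "'c ctx \<Rightarrow> 'c signature \<Rightarrow> bool" where
  "ctx_in \<Gamma> \<Sigma> \<longleftrightarrow> set \<Gamma> \<subseteq> Lambda \<Sigma>"

inductive wf_ctx :: "'c signature \<Rightarrow> 'c rule set \<Rightarrow> 'c ctx \<Rightarrow> bool"
  and has_type :: "'c signature \<Rightarrow> 'c rule set \<Rightarrow> 'c ctx \<Rightarrow> 'c trm \<Rightarrow> 'c trm \<Rightarrow> bool"
  for \<Sigma> R where
  wf_empty: "wf_ctx \<Sigma> R []"
| wf_decl: "has_type \<Sigma> R \<Gamma> A (Sort s) \<Longrightarrow> wf_ctx \<Sigma> R (A # \<Gamma>)"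
| ty_sort: "wf_ctx \<Sigma> R \<Gamma> \<Longrightarrow> has_type \<Sigma> R \<Gamma> (Sort Type) (Sort Kind)"
| ty_const: "wf_ctx \<Sigma> R \<Gamma> \<Longrightarrow> has_type \<Sigma> R [] A (Sort s) \<Longrightarrow> (c, A) \<in> set \<Sigma> \<Longrightarrow>
    has_type \<Sigma> R \<Gamma> (Const c) A"
| ty_var: "wf_ctx \<Sigma> R \<Gamma> \<Longrightarrow> i < length \<Gamma> \<Longrightarrow>
    has_type \<Sigma> R \<Gamma> (Var i) (rename (\<lambda>j. j + Suc i) (\<Gamma> ! i))"
| ty_prod: "has_type \<Sigma> R \<Gamma> A (Sort Type) \<Longrightarrow> has_type \<Sigma> R (A # \<Gamma>) B (Sort s) \<Longrightarrow>
    has_type \<Sigma> R \<Gamma> (Pi A B) (Sort s)"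
| ty_abs: "has_type \<Sigma> R \<Gamma> A (Sort Type) \<Longrightarrow> has_type \<Sigma> R (A # \<Gamma>) B (Sort s) \<Longrightarrow>
    has_type \<Sigma> R (A # \<Gamma>) t B \<Longrightarrow> has_type \<Sigma> R \<Gamma> (Lam A t) (Pi A B)"
| ty_app: "has_type \<Sigma> R \<Gamma> t (Pi A B) \<Longrightarrow> has_type \<Sigma> R \<Gamma> u A \<Longrightarrow>
    has_type \<Sigma> R \<Gamma> (App t u) (inst u B)"
| ty_conv: "has_type \<Sigma> R \<Gamma> t A \<Longrightarrow> has_type \<Sigma> R \<Gamma> B (Sort s) \<Longrightarrow> conv R A B \<Longrightarrow>
    has_type \<Sigma> R \<Gamma> t B"

definition system :: "'c signature \<Rightarrow> 'c rule set \<Rightarrow> bool" where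
  "system \<Sigma> R \<longleftrightarrow> is_signature \<Sigma> \<and>
     (\<forall>(l, r) \<in> R. rewrite_rule (l, r) \<and> l \<in> Lambda \<Sigma> \<and> r \<in> Lambda \<Sigma>)"

definition confluent_system :: "'c signature \<Rightarrow> 'c rule set \<Rightarrow> bool" where
  "confluent_system \<Sigma> R \<longleftrightarrow> system \<Sigma> R \<and>
     (\<forall>t u v. t \<in> Lambda \<Sigma> \<longrightarrow> (beta_rew R)\<^sup>*\<^sup>* t u \<longrightarrow> (beta_rew R)\<^sup>*\<^sup>* t v \<longrightarrow>
        (\<exists>w. (beta_rew R)\<^sup>*\<^sup>* u w \<and> (beta_rew R)\<^sup>*\<^sup>* v w))"

definition rule_preserves_typing :: "'c signature \<Rightarrow> 'c rule set \<Rightarrow> 'c rule \<Rightarrow> bool" where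
  "rule_preserves_typing \<Sigma> R = (\<lambda>(l, r).
     \<forall>\<Gamma> \<theta> A. ctx_in \<Gamma> \<Sigma> \<longrightarrow> range \<theta> \<subseteq> Lambda \<Sigma> \<longrightarrow> A \<in> Lambda \<Sigma> \<longrightarrow>
       has_type \<Sigma> R \<Gamma> (subst \<theta> l) A \<longrightarrow> has_type \<Sigma> R \<Gamma> (subst \<theta> r) A)"

definition preserves_typing :: "'c signature \<Rightarrow> 'c rule set \<Rightarrow> bool" where
  "preserves_typing \<Sigma> R \<longleftrightarrow> (\<forall>\<rho> \<in> R. rule_preserves_typing \<Sigma> R \<rho>)"

definition fragment :: "'c signature \<Rightarrow> 'c rule set \<Rightarrow> 'c signature \<Rightarrow> 'c rule set \<Rightarrow> bool" where
  "fragment \<Sigma>1 R1 \<Sigma>0 R0 \<longleftrightarrow> system \<Sigma>1 R1 \<and>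
     set \<Sigma>1 \<subseteq> set \<Sigma>0 \<and> R1 \<subseteq> R0 \<and>
     (\<forall>(c, A) \<in> set \<Sigma>1. const_of A \<subseteq> sig_consts \<Sigma>1) \<and>
     (\<forall>(l, r) \<in> R0. const_of l \<subseteq> sig_consts \<Sigma>1 \<longrightarrow>
        const_of r \<subseteq> sig_consts \<Sigma>1 \<and> (l, r) \<in> R1)"

text \<open>
  \<open>KIND\<close> is not typable, so it never occurs in the subject of a typing judgement; this condition
  keeps reduction from creating it.  It cannot be dropped from the comparison of a system with its
  fragments: with \<open>\<Sigma>0 = N : TYPE, b : TYPE\<close>, the single rule \<open>b \<hookrightarrow> KIND\<close>, and the fragment
  \<open>N : TYPE\<close> without rules, the term \<open>\<lambda>x:N. TYPE\<close> has type \<open>\<Pi>x:N. b\<close> in the system (convert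
  \<open>KIND\<close> to \<open>b\<close>), but it has no type in the fragment.
\<close>

definition no_new_Kind :: "'c rule set \<Rightarrow> bool" where
  "no_new_Kind R \<longleftrightarrow> (\<forall>(l, r) \<in> R. Kind \<in> sorts_of r \<longrightarrow> Kind \<in> sorts_of l)"

end

theory Submission
  imports Defs
begin

text \<open>
  The derivation in the large system is followed rule by rule. Reducts of terms over the fragment
  stay in the fragment and use only its rules, so the fragment is itself confluent, and the usual
  metatheory (substitution, well-sortedness of types, injectivity of products, subject reduction)
  is available there. In the application and conversion rules, confluence of the large system moves
  the types to a common reduct over the fragment; subject reduction in the fragment shows that this
  reduct is well-sorted, hence a legal target for conversion. In the abstraction rule the codomain
  is replaced by a reduct over the fragment, which has a sort unless it is \<open>KIND\<close>; the latter is
  excluded since a typable term contains no \<open>KIND\<close> and reduction does not create it.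
\<close>

section \<open>Substitution calculus\<close>

lemma up_ren_simps [simp]: "up_ren \<rho> 0 = 0" "up_ren \<rho> (Suc i) = Suc (\<rho> i)"
  by (simp_all add: up_ren_def)

lemma up_simps [simp]: "up \<theta> 0 = Var 0" "up \<theta> (Suc i) = rename Suc (\<theta> i)"
  by (simp_all add: up_def)

text \<open>Makes closed terms invariant under substitution, and later allows a substitution to be
  changed outside the variables of a left-hand side.\<close>

lemma subst_cong_fv: "(\<And>i. i \<in> fv t \<Longrightarrow> \<theta> i = \<theta>' i) \<Longrightarrow> subst \<theta> t = subst \<theta>' t"
proof (induction t arbitrary: \<theta> \<theta>')
  case (Pi A B)
  have "subst (up \<theta>) B = subst (up \<theta>') B"
    by (rule Pi.IH(2)) (use Pi.prems in \<open>auto simp: up_def split: nat.split\<close>)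
  then show ?case using Pi.IH(1)[of \<theta> \<theta>'] Pi.prems by simp
next
  case (Lam A B)
  have "subst (up \<theta>) B = subst (up \<theta>') B"
    by (rule Lam.IH(2)) (use Lam.prems in \<open>auto simp: up_def split: nat.split\<close>)
  then show ?case using Lam.IH(1)[of \<theta> \<theta>'] Lam.prems by simp
next
  case (App t u)
  then show ?case by (metis UnCI fv.simps(6) subst.simps(6))
qed auto

lemma rename_eq_subst: "rename \<rho> t = subst (\<lambda>i. Var (\<rho> i)) t"
proof (induction t arbitrary: \<rho>)
  \<comment> \<open>Only the two binders change the substitution, so one equation about
    \<open>up\<close> settles both the \<open>Pi\<close> and the \<open>Lam\<close> case.\<close>
  have "up (\<lambda>i. Var (\<rho> i)) = (\<lambda>i. Var (up_ren \<rho> i) :: 'a trm)" for \<rho>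
    by (auto simp: up_def up_ren_def fun_eq_iff split: nat.split)
  then show "rename \<rho> (Pi A B) = subst (\<lambda>i. Var (\<rho> i)) (Pi A B)"
    and "rename \<rho> (Lam A B) = subst (\<lambda>i. Var (\<rho> i)) (Lam A B)"
    if "\<And>\<rho>. rename \<rho> A = subst (\<lambda>i. Var (\<rho> i)) A" "\<And>\<rho>. rename \<rho> B = subst (\<lambda>i. Var (\<rho> i)) B"
    for A B :: "'a trm" and \<rho>
    using that by simp_all
qed auto

lemma subst_Var [simp]: "subst Var t = t"
proof (induction t)
  have "up Var = (Var :: nat \<Rightarrow> 'a trm)" by (auto simp: up_def fun_eq_iff split: nat.split)
  then show "subst Var (Pi A B) = Pi A B" and "subst Var (Lam A B) = Lam A B"
    if "subst Var A = A" "subst Var B = B" for A B :: "'a trm"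
    using that by simp_all
qed auto

lemma subst_closed: "fv t = {} \<Longrightarrow> subst \<theta> t = t"
  using subst_cong_fv[of t \<theta> Var] by simp

lemma rename_closed: "fv t = {} \<Longrightarrow> rename \<rho> t = t"
  by (simp add: rename_eq_subst subst_closed)

text \<open>First of four composition laws, in the order that lifting under binders forces:
  \<open>up\<close> is built from \<open>rename Suc\<close>, so composing two substitutions requires
  both mixed laws first.\<close>

lemma subst_rename: "subst \<theta> (rename \<rho> t) = subst (\<lambda>i. \<theta> (\<rho> i)) t"
proof (induction t arbitrary: \<theta> \<rho>)
  have "(\<lambda>i. up \<theta> (up_ren \<rho> i)) = up (\<lambda>i. \<theta> (\<rho> i))" for \<theta> :: "nat \<Rightarrow> 'a trm" and \<rho>
    by (auto simp: up_def up_ren_def fun_eq_iff split: nat.split)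
  then show "subst \<theta> (rename \<rho> (Pi A B)) = subst (\<lambda>i. \<theta> (\<rho> i)) (Pi A B)"
    and "subst \<theta> (rename \<rho> (Lam A B)) = subst (\<lambda>i. \<theta> (\<rho> i)) (Lam A B)"
    if "\<And>\<theta> \<rho>. subst \<theta> (rename \<rho> A) = subst (\<lambda>i. \<theta> (\<rho> i)) A"
      "\<And>\<theta> \<rho>. subst \<theta> (rename \<rho> B) = subst (\<lambda>i. \<theta> (\<rho> i)) B"
    for A B :: "'a trm" and \<theta> \<rho>
    using that by simp_all
qed auto

lemma rename_rename: "rename \<rho> (rename \<rho>' t) = rename (\<lambda>i. \<rho> (\<rho>' i)) t"
  by (simp add: rename_eq_subst[of \<rho>] subst_rename) (simp add: rename_eq_subst)

lemma rename_subst: "rename \<rho> (subst \<theta> t) = subst (\<lambda>i. rename \<rho> (\<theta> i)) t"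
proof (induction t arbitrary: \<theta> \<rho>)
  have "(\<lambda>i. rename (up_ren \<rho>) (up \<theta> i)) = up (\<lambda>i. rename \<rho> (\<theta> i))"
    for \<theta> :: "nat \<Rightarrow> 'a trm" and \<rho>
    by (auto simp: up_def rename_rename fun_eq_iff split: nat.split)
  then show "rename \<rho> (subst \<theta> (Pi A B)) = subst (\<lambda>i. rename \<rho> (\<theta> i)) (Pi A B)"
    and "rename \<rho> (subst \<theta> (Lam A B)) = subst (\<lambda>i. rename \<rho> (\<theta> i)) (Lam A B)"
    if "\<And>\<theta> \<rho>. rename \<rho> (subst \<theta> A) = subst (\<lambda>i. rename \<rho> (\<theta> i)) A"
      "\<And>\<theta> \<rho>. rename \<rho> (subst \<theta> B) = subst (\<lambda>i. rename \<rho> (\<theta> i)) B"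
    for A B :: "'a trm" and \<theta> \<rho>
    using that by simp_all
qed auto

lemma subst_subst: "subst \<theta> (subst \<theta>' t) = subst (\<lambda>i. subst \<theta> (\<theta>' i)) t"
proof (induction t arbitrary: \<theta> \<theta>')
  have "(\<lambda>i. subst (up \<theta>) (up \<theta>' i)) = up (\<lambda>i. subst \<theta> (\<theta>' i))"
    for \<theta> \<theta>' :: "nat \<Rightarrow> 'a trm"
    by (auto simp: up_def subst_rename rename_subst fun_eq_iff split: nat.split)
  then show "subst \<theta> (subst \<theta>' (Pi A B)) = subst (\<lambda>i. subst \<theta> (\<theta>' i)) (Pi A B)"
    and "subst \<theta> (subst \<theta>' (Lam A B)) = subst (\<lambda>i. subst \<theta> (\<theta>' i)) (Lam A B)"
    if "\<And>\<theta> \<theta>'. subst \<theta> (subst \<theta>' A) = subst (\<lambda>i. subst \<theta> (\<theta>' i)) A"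
      "\<And>\<theta> \<theta>'. subst \<theta> (subst \<theta>' B) = subst (\<lambda>i. subst \<theta> (\<theta>' i)) B"
    for A B :: "'a trm" and \<theta> \<theta>'
    using that by simp_all
qed auto

lemma subst_inst: "subst \<theta> (inst u t) = inst (subst \<theta> u) (subst (up \<theta>) t)"
proof -
  have "(\<lambda>i. subst \<theta> (case_nat u Var i)) = (\<lambda>i. subst (case_nat (subst \<theta> u) Var) (up \<theta> i))"
    by (auto simp: up_def subst_rename fun_eq_iff split: nat.split)
  then show ?thesis by (simp add: inst_def subst_subst)
qed

lemma const_of_rename [simp]: "const_of (rename \<rho> t) = const_of t"
  by (induction t arbitrary: \<rho>) auto

text \<open>Equality matters: if an instance of a left-hand side lies over a set of constants, then
  so do the left-hand side itself and the images of its variables.\<close>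

lemma const_of_subst: "const_of (subst \<theta> t) = const_of t \<union> (\<Union>i\<in>fv t. const_of (\<theta> i))"
proof (induction t arbitrary: \<theta>)
  have "(\<Union>i\<in>fv B. const_of (up \<theta> i)) = (\<Union>i\<in>{i. Suc i \<in> fv B}. const_of (\<theta> i))"
    for \<theta> :: "nat \<Rightarrow> 'a trm" and B :: "'a trm"
  proof safe
    fix c i assume "i \<in> fv B" "c \<in> const_of (up \<theta> i)"
    then show "c \<in> (\<Union>i\<in>{i. Suc i \<in> fv B}. const_of (\<theta> i))" by (cases i) auto
  next
    fix c i assume "Suc i \<in> fv B" "c \<in> const_of (\<theta> i)"
    then show "c \<in> (\<Union>i\<in>fv B. const_of (up \<theta> i))" by (intro UN_I[of "Suc i"]) auto
  qed
  then show "const_of (subst \<theta> (Pi A B)) = const_of (Pi A B) \<union> (\<Union>i\<in>fv (Pi A B). const_of (\<theta> i))"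
    and "const_of (subst \<theta> (Lam A B)) = const_of (Lam A B) \<union> (\<Union>i\<in>fv (Lam A B). const_of (\<theta> i))"
    if "\<And>\<theta>. const_of (subst \<theta> A) = const_of A \<union> (\<Union>i\<in>fv A. const_of (\<theta> i))"
      "\<And>\<theta>. const_of (subst \<theta> B) = const_of B \<union> (\<Union>i\<in>fv B. const_of (\<theta> i))"
    for A B :: "'a trm" and \<theta>
    using that by (simp_all add: Un_ac)
qed auto

lemma sorts_of_rename [simp]: "sorts_of (rename \<rho> t) = sorts_of t"
  by (induction t arbitrary: \<rho>) auto

lemma sorts_of_subst: "sorts_of (subst \<theta> t) = sorts_of t \<union> (\<Union>i\<in>fv t. sorts_of (\<theta> i))"
proof (induction t arbitrary: \<theta>)
  have "(\<Union>i\<in>fv B. sorts_of (up \<theta> i)) = (\<Union>i\<in>{i. Suc i \<in> fv B}. sorts_of (\<theta> i))"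
    for \<theta> :: "nat \<Rightarrow> 'a trm" and B :: "'a trm"
  proof safe
    fix c i assume "i \<in> fv B" "c \<in> sorts_of (up \<theta> i)"
    then show "c \<in> (\<Union>i\<in>{i. Suc i \<in> fv B}. sorts_of (\<theta> i))" by (cases i) auto
  next
    fix c i assume "Suc i \<in> fv B" "c \<in> sorts_of (\<theta> i)"
    then show "c \<in> (\<Union>i\<in>fv B. sorts_of (up \<theta> i))" by (intro UN_I[of "Suc i"]) auto
  qed
  then show "sorts_of (subst \<theta> (Pi A B)) = sorts_of (Pi A B) \<union> (\<Union>i\<in>fv (Pi A B). sorts_of (\<theta> i))"
    and "sorts_of (subst \<theta> (Lam A B)) = sorts_of (Lam A B) \<union> (\<Union>i\<in>fv (Lam A B). sorts_of (\<theta> i))"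
    if "\<And>\<theta>. sorts_of (subst \<theta> A) = sorts_of A \<union> (\<Union>i\<in>fv A. sorts_of (\<theta> i))"
      "\<And>\<theta>. sorts_of (subst \<theta> B) = sorts_of B \<union> (\<Union>i\<in>fv B. sorts_of (\<theta> i))"
    for A B :: "'a trm" and \<theta>
    using that by (simp_all add: Un_ac)
qed auto

lemma const_of_inst_subset: "const_of (inst u t) \<subseteq> const_of u \<union> const_of t"
  by (auto simp: inst_def const_of_subst split: nat.splits)

lemma sorts_of_inst_subset: "sorts_of (inst u t) \<subseteq> sorts_of u \<union> sorts_of t"
  by (auto simp: inst_def sorts_of_subst split: nat.splits)

section \<open>Reduction\<close>

text \<open>
  Substitution is applied at the redex only, so that the position of the redex can be
  recovered by inversion, unlike with \<^const>\<open>rew\<close>.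
\<close>

inductive red :: "'c rule set \<Rightarrow> 'c trm \<Rightarrow> 'c trm \<Rightarrow> bool" for R where
  red_beta: "red R (App (Lam A t) u) (inst u t)"
| red_rule: "(l, r) \<in> R \<Longrightarrow> red R (subst \<theta> l) (subst \<theta> r)"
| red_Pi1: "red R A A' \<Longrightarrow> red R (Pi A B) (Pi A' B)"
| red_Pi2: "red R B B' \<Longrightarrow> red R (Pi A B) (Pi A B')"
| red_Lam1: "red R A A' \<Longrightarrow> red R (Lam A t) (Lam A' t)"
| red_Lam2: "red R t t' \<Longrightarrow> red R (Lam A t) (Lam A t')"
| red_App1: "red R t t' \<Longrightarrow> red R (App t u) (App t' u)"
| red_App2: "red R u u' \<Longrightarrow> red R (App t u) (App t u')"

text \<open>Two successive substitutions compose into one, so closure under substitution, a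
  constructor of \<open>rew\<close>, is admissible for \<open>red\<close>.\<close>

lemma red_subst: "red R t u \<Longrightarrow> red R (subst \<theta> t) (subst \<theta> u)"
proof (induction arbitrary: \<theta> rule: red.induct)
  case red_beta
  show ?case by (simp add: subst_inst red.red_beta)
next
  case red_rule
  then show ?case by (simp add: subst_subst red.red_rule)
qed (auto intro: red.intros)

lemma beta_rew_eq_red: "beta_rew R = red R"
proof (intro ext iffI)
  fix t u
  have "red R t u" if "beta t u" for t u
    using that by induction (auto intro: red.intros)
  moreover have "red R t u" if "rew R t u" for t u
    using that
  proof induction
    case (rew_rule l r)
    \<comment> \<open>A bare rule is its own instance by the identity substitution
      \<open>Var\<close>.\<close>
    then show ?case using red.red_rule[of l r R Var] by simp
  qed (auto intro: red.intros red_subst)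
  ultimately show "red R t u" if "beta_rew R t u" using that by (auto simp: beta_rew_def)
  show "beta_rew R t u" if "red R t u"
    using that
    by induction (auto simp: beta_rew_def intro: beta.intros rew.intros)
qed

section \<open>Many-step reduction under constructors and substitutions\<close>

lemma reds_App: "(red R)\<^sup>*\<^sup>* t t' \<Longrightarrow> (red R)\<^sup>*\<^sup>* u u' \<Longrightarrow> (red R)\<^sup>*\<^sup>* (App t u) (App t' u')"
proof -
  assume "(red R)\<^sup>*\<^sup>* u u'"
  then have "(red R)\<^sup>*\<^sup>* (App t u) (App t u')"
    by induction (auto intro: red_App2 rtranclp.rtrancl_into_rtrancl)
  moreover assume "(red R)\<^sup>*\<^sup>* t t'"
  then have "(red R)\<^sup>*\<^sup>* (App t u') (App t' u')"
    by induction (auto intro: red_App1 rtranclp.rtrancl_into_rtrancl)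
  ultimately show ?thesis by (rule rtranclp_trans)
qed

lemma reds_Lam: "(red R)\<^sup>*\<^sup>* t t' \<Longrightarrow> (red R)\<^sup>*\<^sup>* u u' \<Longrightarrow> (red R)\<^sup>*\<^sup>* (Lam t u) (Lam t' u')"
proof -
  assume "(red R)\<^sup>*\<^sup>* u u'"
  then have "(red R)\<^sup>*\<^sup>* (Lam t u) (Lam t u')"
    by induction (auto intro: red_Lam2 rtranclp.rtrancl_into_rtrancl)
  moreover assume "(red R)\<^sup>*\<^sup>* t t'"
  then have "(red R)\<^sup>*\<^sup>* (Lam t u') (Lam t' u')"
    by induction (auto intro: red_Lam1 rtranclp.rtrancl_into_rtrancl)
  ultimately show ?thesis by (rule rtranclp_trans)
qed

lemma reds_Pi: "(red R)\<^sup>*\<^sup>* t t' \<Longrightarrow> (red R)\<^sup>*\<^sup>* u u' \<Longrightarrow> (red R)\<^sup>*\<^sup>* (Pi t u) (Pi t' u')"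
proof -
  assume "(red R)\<^sup>*\<^sup>* u u'"
  then have "(red R)\<^sup>*\<^sup>* (Pi t u) (Pi t u')"
    by induction (auto intro: red_Pi2 rtranclp.rtrancl_into_rtrancl)
  moreover assume "(red R)\<^sup>*\<^sup>* t t'"
  then have "(red R)\<^sup>*\<^sup>* (Pi t u') (Pi t' u')"
    by induction (auto intro: red_Pi1 rtranclp.rtrancl_into_rtrancl)
  ultimately show ?thesis by (rule rtranclp_trans)
qed

lemma reds_subst: "(red R)\<^sup>*\<^sup>* t u \<Longrightarrow> (red R)\<^sup>*\<^sup>* (subst \<theta> t) (subst \<theta> u)"
  by (induction rule: rtranclp_induct) (auto intro: red_subst rtranclp.rtrancl_into_rtrancl)

lemma reds_rename: "(red R)\<^sup>*\<^sup>* t u \<Longrightarrow> (red R)\<^sup>*\<^sup>* (rename \<rho> t) (rename \<rho> u)"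
  by (simp add: rename_eq_subst reds_subst)

text \<open>A step in the image of a variable is repeated at each occurrence of that variable,
  possibly zero times, hence the many-step relation in the conclusion.\<close>

lemma reds_subst_args: "(\<And>i. (red R)\<^sup>*\<^sup>* (\<theta> i) (\<theta>' i)) \<Longrightarrow> (red R)\<^sup>*\<^sup>* (subst \<theta> t) (subst \<theta>' t)"
proof (induction t arbitrary: \<theta> \<theta>')
  case (Pi A B)
  have "(red R)\<^sup>*\<^sup>* (up \<theta> i) (up \<theta>' i)" for i
    using Pi.prems by (cases i) (auto intro: reds_rename)
  then show ?case using Pi by (simp add: reds_Pi)
next
  case (Lam A B)
  have "(red R)\<^sup>*\<^sup>* (up \<theta> i) (up \<theta>' i)" for i
    using Lam.prems by (cases i) (auto intro: reds_rename)
  then show ?case using Lam by (simp add: reds_Lam)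
qed (auto intro: reds_App)

lemma reds_inst: "(red R)\<^sup>*\<^sup>* t t' \<Longrightarrow> (red R)\<^sup>*\<^sup>* (inst u t) (inst u t')"
  by (simp add: inst_def reds_subst)

lemma reds_inst_arg: "(red R)\<^sup>*\<^sup>* u u' \<Longrightarrow> (red R)\<^sup>*\<^sup>* (inst u t) (inst u' t)"
  unfolding inst_def by (rule reds_subst_args) (auto split: nat.split)

section \<open>Conversion\<close>

lemma conv_refl [simp]: "conv R t t"
  by (simp add: conv_def)

lemma conv_sym: "conv R t u \<Longrightarrow> conv R u t"
  by (simp add: conv_def equivclp_sym)

lemma conv_trans [trans]: "conv R t u \<Longrightarrow> conv R u v \<Longrightarrow> conv R t v"
  unfolding conv_def by (rule equivclp_trans)

lemma reds_imp_conv: "(red R)\<^sup>*\<^sup>* t u \<Longrightarrow> conv R t u"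
  unfolding conv_def beta_rew_eq_red by (induction rule: rtranclp_induct) (auto intro: equivclp_into_equivclp)

lemma red_imp_conv: "red R t u \<Longrightarrow> conv R t u"
  by (auto intro: reds_imp_conv)

lemma conv_map:
  assumes "conv R t u" and "\<And>t u. red R t u \<Longrightarrow> red R (f t) (f u)"
  shows "conv R (f t) (f u)"
  using assms(1) unfolding conv_def beta_rew_eq_red
  by (induction rule: equivclp_induct) (auto intro: assms(2) equivclp_into_equivclp)

lemma conv_subst: "conv R t u \<Longrightarrow> conv R (subst \<theta> t) (subst \<theta> u)"
  by (erule conv_map) (rule red_subst)

lemma conv_inst: "conv R t t' \<Longrightarrow> conv R (inst u t) (inst u t')"
  by (simp add: inst_def conv_subst)

lemma conv_rename: "conv R t u \<Longrightarrow> conv R (rename \<rho> t) (rename \<rho> u)"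
  by (simp add: rename_eq_subst conv_subst)

text \<open>A rule that fires on a term over \<open>S\<close> has its left-hand side over
  \<open>S\<close>, so it belongs to \<open>R1\<close> and its right-hand side is over
  \<open>S\<close>. As \<open>fv r \<subseteq> fv l\<close>, the images of the variables of
  \<open>r\<close> already occur in the redex and bring no new constant.\<close>

lemma red_restrict:
  assumes "red R0 t t'" and "const_of t \<subseteq> S"
    and "\<And>l r. (l, r) \<in> R0 \<Longrightarrow> const_of l \<subseteq> S \<Longrightarrow> const_of r \<subseteq> S \<and> (l, r) \<in> R1"
    and "\<And>l r. (l, r) \<in> R0 \<Longrightarrow> fv r \<subseteq> fv l"
  shows "const_of t' \<subseteq> S \<and> red R1 t t'"
  using assms(1,2)
proof induction
  case (red_beta A t u)
  then show ?case using const_of_inst_subset[of u t] by (auto intro: red.red_beta)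
next
  case (red_rule l r \<theta>)
  then have "const_of l \<subseteq> S" by (simp add: const_of_subst)
  then have r: "const_of r \<subseteq> S" "(l, r) \<in> R1" using assms(3) red_rule.hyps by auto
  have "const_of (subst \<theta> r) \<subseteq> S"
    using r(1) red_rule.prems assms(4)[OF red_rule.hyps] unfolding const_of_subst by blast
  with r(2) show ?case by (simp add: red.red_rule)
qed (auto intro: red.intros)

lemma reds_restrict:
  assumes "(red R0)\<^sup>*\<^sup>* t t'" and "const_of t \<subseteq> S"
    and "\<And>l r. (l, r) \<in> R0 \<Longrightarrow> const_of l \<subseteq> S \<Longrightarrow> const_of r \<subseteq> S \<and> (l, r) \<in> R1"
    and "\<And>l r. (l, r) \<in> R0 \<Longrightarrow> fv r \<subseteq> fv l"
  shows "const_of t' \<subseteq> S \<and> (red R1)\<^sup>*\<^sup>* t t'"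
  using assms(1,2)
proof (induction rule: rtranclp_induct)
  case (step u v)
  then show ?case using red_restrict[OF step(2) _ assms(3,4)]
    by (auto intro: rtranclp.rtrancl_into_rtrancl)
qed simp

section \<open>Erasure of foreign constants\<close>

text \<open>\<open>Sort Type\<close> serves as a dummy: it contains no constant and is fixed by
  renaming and substitution, so erasure commutes with both.\<close>

primrec erase :: "'c set \<Rightarrow> 'c trm \<Rightarrow> 'c trm" where
  "erase S (Const c) = (if c \<in> S then Const c else Sort Type)"
| "erase S (Var i) = Var i"
| "erase S (Sort s) = Sort s"
| "erase S (Pi A B) = Pi (erase S A) (erase S B)"
| "erase S (Lam A t) = Lam (erase S A) (erase S t)"
| "erase S (App t u) = App (erase S t) (erase S u)"

lemma const_of_erase: "const_of (erase S t) \<subseteq> S"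
  by (induction t) auto

lemma erase_id: "const_of t \<subseteq> S \<Longrightarrow> erase S t = t"
  by (induction t) auto

lemma erase_rename: "erase S (rename \<rho> t) = rename \<rho> (erase S t)"
  by (induction t arbitrary: \<rho>) auto

lemma erase_subst: "erase S (subst \<theta> t) = subst (\<lambda>i. erase S (\<theta> i)) (erase S t)"
proof (induction t arbitrary: \<theta>)
  have "(\<lambda>i. erase S (up \<theta> i)) = up (\<lambda>i. erase S (\<theta> i))" for \<theta>
    by (auto simp: up_def erase_rename fun_eq_iff split: nat.split)
  then show "erase S (subst \<theta> (Pi A B)) = subst (\<lambda>i. erase S (\<theta> i)) (erase S (Pi A B))"
    and "erase S (subst \<theta> (Lam A B)) = subst (\<lambda>i. erase S (\<theta> i)) (erase S (Lam A B))"
    if "\<And>\<theta>. erase S (subst \<theta> A) = subst (\<lambda>i. erase S (\<theta> i)) (erase S A)"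
      "\<And>\<theta>. erase S (subst \<theta> B) = subst (\<lambda>i. erase S (\<theta> i)) (erase S B)"
    for A B :: "'a trm" and \<theta>
    using that by simp_all
qed auto

lemma erase_inst: "erase S (inst u t) = inst (erase S u) (erase S t)"
proof -
  have "(\<lambda>i. erase S (case_nat u Var i)) = case_nat (erase S u) Var"
    by (auto simp: fun_eq_iff split: nat.split)
  then show ?thesis by (simp add: inst_def erase_subst)
qed

text \<open>Erasure fixes both sides of every rule, so an erased rule instance is an instance of the
  same rule by the erased substitution.\<close>

lemma red_erase:
  assumes "red R t u" and "\<And>l r. (l, r) \<in> R \<Longrightarrow> const_of l \<subseteq> S \<and> const_of r \<subseteq> S"
  shows "red R (erase S t) (erase S u)"
  using assms(1)
proof induction
  case (red_rule l r \<theta>)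
  then show ?case using assms(2)[of l r] by (simp add: erase_subst erase_id red.red_rule)
qed (auto simp: erase_inst intro: red.intros)

section \<open>Typing in a system\<close>

abbreviation lookup :: "'c ctx \<Rightarrow> nat \<Rightarrow> 'c trm" where
  "lookup \<Gamma> i \<equiv> rename (\<lambda>j. j + Suc i) (\<Gamma> ! i)"

lemma lookup_Cons_Suc: "lookup (A # \<Gamma>) (Suc i) = rename Suc (lookup \<Gamma> i)"
  by (simp add: rename_rename)

lemma has_type_wf_ctx: "has_type \<Sigma> R \<Gamma> t A \<Longrightarrow> wf_ctx \<Sigma> R \<Gamma>"
  \<comment> \<open>Facts about typing alone use the mutual induction with the trivial predicate for
    contexts.\<close>
  by (induction rule: wf_ctx_has_type.inducts(2)[where ?P1.0 = "\<lambda>_. True"]) auto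

lemma wf_ctx_ConsE:
  assumes "wf_ctx \<Sigma> R (A # \<Gamma>)"
  obtains s where "has_type \<Sigma> R \<Gamma> A (Sort s)"
  using assms by (auto elim: wf_ctx.cases)

lemma has_type_PiE:
  assumes "has_type \<Sigma> R \<Gamma> (Pi A B) C"
  obtains s where "has_type \<Sigma> R \<Gamma> A (Sort Type)" "has_type \<Sigma> R (A # \<Gamma>) B (Sort s)"
proof -
  have "has_type \<Sigma> R \<Gamma> t C \<Longrightarrow> t = Pi A B \<Longrightarrow>
    \<exists>s. has_type \<Sigma> R \<Gamma> A (Sort Type) \<and> has_type \<Sigma> R (A # \<Gamma>) B (Sort s)" for t
    by (induction rule: wf_ctx_has_type.inducts(2)[where ?P1.0 = "\<lambda>_. True"]) auto
  with assms that show thesis by blast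
qed

text \<open>Conversion keeps the subject, so a derivation ends with the abstraction rule followed by
  conversions, which accumulate in \<open>conv R (Pi A B) C\<close>.\<close>

lemma has_type_LamE:
  assumes "has_type \<Sigma> R \<Gamma> (Lam A t) C"
  obtains B s where "has_type \<Sigma> R \<Gamma> A (Sort Type)" "has_type \<Sigma> R (A # \<Gamma>) B (Sort s)"
    "has_type \<Sigma> R (A # \<Gamma>) t B" "conv R (Pi A B) C"
proof -
  have "has_type \<Sigma> R \<Gamma> t' C \<Longrightarrow> t' = Lam A t \<Longrightarrow>
    \<exists>B s. has_type \<Sigma> R \<Gamma> A (Sort Type) \<and> has_type \<Sigma> R (A # \<Gamma>) B (Sort s) \<and>
      has_type \<Sigma> R (A # \<Gamma>) t B \<and> conv R (Pi A B) C" for t'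
    by (induction rule: wf_ctx_has_type.inducts(2)[where ?P1.0 = "\<lambda>_. True"])
      (auto intro: conv_trans)
  with assms that show thesis by blast
qed

text \<open>Each subject is built from constants, variables, \<open>Sort Type\<close> and subjects
  of premises; no rule types \<open>Sort Kind\<close>.\<close>

lemma has_type_subject_Kind: "has_type \<Sigma> R \<Gamma> t A \<Longrightarrow> Kind \<notin> sorts_of t"
  by (induction rule: wf_ctx_has_type.inducts(2)[where ?P1.0 = "\<lambda>_. True"]) auto

lemma in_Lambda_simps [simp]:
  "Const c \<in> Lambda \<Sigma> \<longleftrightarrow> c \<in> sig_consts \<Sigma>"
  "Var i \<in> Lambda \<Sigma>"
  "Sort s \<in> Lambda \<Sigma>"
  "Pi A B \<in> Lambda \<Sigma> \<longleftrightarrow> A \<in> Lambda \<Sigma> \<and> B \<in> Lambda \<Sigma>"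
  "Lam A B \<in> Lambda \<Sigma> \<longleftrightarrow> A \<in> Lambda \<Sigma> \<and> B \<in> Lambda \<Sigma>"
  "App A B \<in> Lambda \<Sigma> \<longleftrightarrow> A \<in> Lambda \<Sigma> \<and> B \<in> Lambda \<Sigma>"
  "rename \<rho> t \<in> Lambda \<Sigma> \<longleftrightarrow> t \<in> Lambda \<Sigma>"
  by (auto simp: Lambda_def)

lemma inst_in_Lambda: "u \<in> Lambda \<Sigma> \<Longrightarrow> t \<in> Lambda \<Sigma> \<Longrightarrow> inst u t \<in> Lambda \<Sigma>"
  using const_of_inst_subset[of u t] by (auto simp: Lambda_def)

text \<open>The types introduced by \<open>ty_const\<close> and \<open>ty_conv\<close> are
  themselves subjects of premises, so the induction covers them. Hence the terms of a judgement lie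
  where confluence is assumed.\<close>

lemma
  shows wf_ctx_in_Lambda: "wf_ctx \<Sigma> R \<Gamma> \<Longrightarrow> ctx_in \<Gamma> \<Sigma>"
    and has_type_in_Lambda: "has_type \<Sigma> R \<Gamma> t A \<Longrightarrow> ctx_in \<Gamma> \<Sigma> \<and> t \<in> Lambda \<Sigma> \<and> A \<in> Lambda \<Sigma>"
proof (induction rule: wf_ctx_has_type.inducts)
  case (ty_const \<Gamma> A s c)
  then show ?case by (auto simp: sig_consts_def intro: image_eqI[of _ fst "(c, A)"])
next
  case (ty_var \<Gamma> i)
  then show ?case by (auto simp: ctx_in_def)
qed (auto simp: ctx_in_def inst_in_Lambda)

locale lp_system =
  fixes \<Sigma> :: "'c signature" and R :: "'c rule set"
  assumes system: "system \<Sigma> R"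
begin

lemma sig_closed: "(c, A) \<in> set \<Sigma> \<Longrightarrow> fv A = {}"
  using system by (auto simp: system_def is_signature_def)

lemma rule_fv: "(l, r) \<in> R \<Longrightarrow> fv r \<subseteq> fv l"
  using system by (auto simp: system_def rewrite_rule_def)

lemma rule_head: "(l, r) \<in> R \<Longrightarrow> \<exists>c ls. l = foldl App (Const c) ls"
  using system by (fastforce simp: system_def rewrite_rule_def)

lemma rule_const: "(l, r) \<in> R \<Longrightarrow> const_of l \<subseteq> sig_consts \<Sigma> \<and> const_of r \<subseteq> sig_consts \<Sigma>"
  using system by (auto simp: system_def Lambda_def)

section \<open>Shapes of redexes and of reducts\<close>

text \<open>Substitution fixes the constant at the head, so no rule fires at the root of a sort,
  variable, product or abstraction.\<close>

lemma subst_lhs_cases: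
  assumes "(l, r) \<in> R"
  obtains c where "subst \<theta> l = Const c" | t u where "subst \<theta> l = App t u"
proof -
  obtain c ls where "l = foldl App (Const c) ls" using rule_head[OF assms] by blast
  \<comment> \<open>The outermost application carries the last argument, so the list is split at its
    end.\<close>
  then show thesis using that by (cases ls rule: rev_cases) auto
qed

lemma not_red_Sort: "\<not> red R (Sort s) t"
proof
  assume "red R (Sort s) t"
  then obtain l r \<theta> where "Sort s = subst \<theta> l" "(l, r) \<in> R" by (cases) auto
  then show False by (metis subst_lhs_cases trm.distinct)
qed

text \<open>Sorts are normal. When the large system assigns a sort, the reduct obtained for the
  fragment is therefore that same sort.\<close>

lemma reds_SortD: "(red R)\<^sup>*\<^sup>* (Sort s) t \<Longrightarrow> t = Sort s"
  by (erule converse_rtranclpE) (auto simp: not_red_Sort)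

lemma not_red_Var: "\<not> red R (Var i) t"
proof
  assume "red R (Var i) t"
  then obtain l r \<theta> where "Var i = subst \<theta> l" "(l, r) \<in> R" by (cases) auto
  then show False by (metis subst_lhs_cases trm.distinct)
qed

lemma red_PiE:
  assumes "red R (Pi A B) C"
  obtains A' where "C = Pi A' B" "red R A A'" | B' where "C = Pi A B'" "red R B B'"
  using assms
proof cases
  case (red_rule l r \<theta>)
  then show thesis by (metis subst_lhs_cases trm.distinct)
qed auto

lemma red_LamE:
  assumes "red R (Lam A B) C"
  obtains A' where "C = Lam A' B" "red R A A'" | B' where "C = Lam A B'" "red R B B'"
  using assms
proof cases
  case (red_rule l r \<theta>)
  then show thesis by (metis subst_lhs_cases trm.distinct)
qed auto

lemma reds_PiD:
  assumes "(red R)\<^sup>*\<^sup>* (Pi A B) C"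
  shows "\<exists>A' B'. C = Pi A' B' \<and> (red R)\<^sup>*\<^sup>* A A' \<and> (red R)\<^sup>*\<^sup>* B B'"
  using assms
proof (induction rule: rtranclp_induct)
  case (step D E)
  then show ?case by (fastforce elim: red_PiE intro: rtranclp.rtrancl_into_rtrancl)
qed simp

text \<open>In a rule step, \<open>Kind\<close> comes either from \<open>r\<close>, hence from
  \<open>l\<close>, or from the image of a variable of \<open>r\<close>, which also occurs in
  \<open>l\<close>.\<close>

lemma reds_no_new_Kind:
  assumes "no_new_Kind R" "(red R)\<^sup>*\<^sup>* t t'" "Kind \<notin> sorts_of t"
  shows "Kind \<notin> sorts_of t'"
proof -
  have "Kind \<in> sorts_of u \<Longrightarrow> Kind \<in> sorts_of t" if "red R t u" for t u
    using that
  proof induction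
    case (red_beta A t u)
    then show ?case using sorts_of_inst_subset[of u t] by auto
  next
    case (red_rule l r \<theta>)
    then show ?case using assms(1) rule_fv[of l r] by (auto simp: no_new_Kind_def sorts_of_subst)
  qed auto
  with assms(2,3) show ?thesis by (induction rule: rtranclp_induct) auto
qed

section \<open>Renaming and substitution in typing derivations\<close>

text \<open>Weakening generalised to arbitrary renamings, since under a binder a shift becomes its
  extension by \<open>up_ren\<close>.\<close>

lemma has_type_rename:
  assumes "has_type \<Sigma> R \<Gamma> t A" and "wf_ctx \<Sigma> R \<Delta>"
    and "\<And>i. i < length \<Gamma> \<Longrightarrow> \<rho> i < length \<Delta> \<and> lookup \<Delta> (\<rho> i) = rename \<rho> (lookup \<Gamma> i)"
  shows "has_type \<Sigma> R \<Delta> (rename \<rho> t) (rename \<rho> A)"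
proof -
  have up: "up_ren \<rho> i < length (rename \<rho> A # \<Delta>) \<and>
      lookup (rename \<rho> A # \<Delta>) (up_ren \<rho> i) = rename (up_ren \<rho>) (lookup (A # \<Gamma>) i)"
    if "\<And>i. i < length \<Gamma> \<Longrightarrow> \<rho> i < length \<Delta> \<and> lookup \<Delta> (\<rho> i) = rename \<rho> (lookup \<Gamma> i)"
      and "i < length (A # \<Gamma>)"
    for \<Gamma> \<Delta> \<rho> i and A :: "'c trm"
  proof (cases i)
    case 0
    then show ?thesis by (simp add: rename_rename)
  next
    case (Suc j)
    then have "j < length \<Gamma>" using that(2) by simp
    with that(1)[OF this] show ?thesis
      unfolding Suc up_ren_simps lookup_Cons_Suc by (simp add: rename_rename)
  qed
  show ?thesis using assms
  proof (induction arbitrary: \<rho> \<Delta> rule: wf_ctx_has_type.inducts(2)[where ?P1.0 = "\<lambda>_. True"])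
    case (ty_const \<Gamma> A s c)
    then show ?case by (simp add: rename_closed[OF sig_closed] wf_ctx_has_type.ty_const)
  next
    case (ty_var \<Gamma> i)
    then show ?case using wf_ctx_has_type.ty_var[of \<Sigma> R \<Delta> "\<rho> i"] by simp
  next
    case (ty_prod \<Gamma> A B s)
    have A: "has_type \<Sigma> R \<Delta> (rename \<rho> A) (Sort Type)"
      using ty_prod.IH(1)[OF ty_prod.prems] by simp
    have "has_type \<Sigma> R (rename \<rho> A # \<Delta>) (rename (up_ren \<rho>) B) (Sort s)"
      using ty_prod.IH(2)[OF wf_decl[OF A] up[OF ty_prod.prems(2)]] by simp
    with A show ?case by (simp add: wf_ctx_has_type.ty_prod)
  next
    case (ty_abs \<Gamma> A B s t)
    have A: "has_type \<Sigma> R \<Delta> (rename \<rho> A) (Sort Type)"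
      using ty_abs.IH(1)[OF ty_abs.prems] by simp
    have "has_type \<Sigma> R (rename \<rho> A # \<Delta>) (rename (up_ren \<rho>) B) (Sort s)"
      using ty_abs.IH(2)[OF wf_decl[OF A] up[OF ty_abs.prems(2)]] by simp
    moreover have "has_type \<Sigma> R (rename \<rho> A # \<Delta>) (rename (up_ren \<rho>) t) (rename (up_ren \<rho>) B)"
      using ty_abs.IH(3)[OF wf_decl[OF A] up[OF ty_abs.prems(2)]] by simp
    ultimately show ?case using A by (simp add: wf_ctx_has_type.ty_abs)
  next
    case (ty_app \<Gamma> t A B u)
    have "rename \<rho> (inst u B) = inst (rename \<rho> u) (rename (up_ren \<rho>) B)"
    proof -
      \<comment> \<open>Viewing the renaming as a substitution makes \<open>subst_inst\<close>
        applicable.\<close>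
      have "up (\<lambda>i. Var (\<rho> i)) = (\<lambda>i. Var (up_ren \<rho> i) :: 'c trm)"
        by (auto simp: up_def up_ren_def fun_eq_iff split: nat.split)
      then show ?thesis by (simp add: rename_eq_subst subst_inst)
    qed
    moreover have "has_type \<Sigma> R \<Delta> (rename \<rho> t) (Pi (rename \<rho> A) (rename (up_ren \<rho>) B))"
      using ty_app.IH(1)[OF ty_app.prems] by simp
    ultimately show ?case
      using ty_app.IH(2)[OF ty_app.prems] by (simp add: wf_ctx_has_type.ty_app)
  next
    case (ty_conv \<Gamma> t A B s)
    then show ?case
      by (metis conv_rename rename.simps(3) wf_ctx_has_type.ty_conv)
  qed (auto intro: wf_ctx_has_type.intros)
qed

lemma has_type_weaken:
  assumes "has_type \<Sigma> R \<Gamma> t A" and "wf_ctx \<Sigma> R (B # \<Gamma>)"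
  shows "has_type \<Sigma> R (B # \<Gamma>) (rename Suc t) (rename Suc A)"
  by (rule has_type_rename[OF assms]) (simp add: rename_rename)

text \<open>Simultaneous substitution makes the induction pass under binders; there, weakening types
  the shifted images.\<close>

lemma has_type_subst:
  assumes "has_type \<Sigma> R \<Gamma> t A" and "wf_ctx \<Sigma> R \<Delta>"
    and "\<And>i. i < length \<Gamma> \<Longrightarrow> has_type \<Sigma> R \<Delta> (\<theta> i) (subst \<theta> (lookup \<Gamma> i))"
  shows "has_type \<Sigma> R \<Delta> (subst \<theta> t) (subst \<theta> A)"
proof -
  have up: "has_type \<Sigma> R (subst \<theta> A # \<Delta>) (up \<theta> i) (subst (up \<theta>) (lookup (A # \<Gamma>) i))"
    if "has_type \<Sigma> R \<Delta> (subst \<theta> A) (Sort Type)"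
      and "\<And>i. i < length \<Gamma> \<Longrightarrow> has_type \<Sigma> R \<Delta> (\<theta> i) (subst \<theta> (lookup \<Gamma> i))"
      and "i < length (A # \<Gamma>)"
    for \<Gamma> \<Delta> \<theta> i A
  proof (cases i)
    case 0
    have "has_type \<Sigma> R (subst \<theta> A # \<Delta>) (Var 0) (lookup (subst \<theta> A # \<Delta>) 0)"
      using that(1) by (intro ty_var wf_decl) auto
    then show ?thesis using 0 by (simp add: subst_rename rename_subst)
  next
    case (Suc j)
    then have "has_type \<Sigma> R \<Delta> (\<theta> j) (subst \<theta> (lookup \<Gamma> j))" using that by simp
    from has_type_weaken[OF this wf_decl[OF that(1)]] show ?thesis
      unfolding Suc lookup_Cons_Suc by (simp add: subst_rename rename_subst)
  qed
  show ?thesis using assms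
  proof (induction arbitrary: \<theta> \<Delta> rule: wf_ctx_has_type.inducts(2)[where ?P1.0 = "\<lambda>_. True"])
    case (ty_const \<Gamma> A s c)
    then show ?case by (simp add: subst_closed[OF sig_closed] wf_ctx_has_type.ty_const)
  next
    case (ty_prod \<Gamma> A B s)
    have A: "has_type \<Sigma> R \<Delta> (subst \<theta> A) (Sort Type)"
      using ty_prod.IH(1)[OF ty_prod.prems] by simp
    have "has_type \<Sigma> R (subst \<theta> A # \<Delta>) (subst (up \<theta>) B) (Sort s)"
      using ty_prod.IH(2)[OF wf_decl[OF A] up[OF A ty_prod.prems(2)]] by simp
    with A show ?case by (simp add: wf_ctx_has_type.ty_prod)
  next
    case (ty_abs \<Gamma> A B s t)
    have A: "has_type \<Sigma> R \<Delta> (subst \<theta> A) (Sort Type)"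
      using ty_abs.IH(1)[OF ty_abs.prems] by simp
    have "has_type \<Sigma> R (subst \<theta> A # \<Delta>) (subst (up \<theta>) B) (Sort s)"
      using ty_abs.IH(2)[OF wf_decl[OF A] up[OF A ty_abs.prems(2)]] by simp
    moreover have "has_type \<Sigma> R (subst \<theta> A # \<Delta>) (subst (up \<theta>) t) (subst (up \<theta>) B)"
      using ty_abs.IH(3)[OF wf_decl[OF A] up[OF A ty_abs.prems(2)]] by simp
    ultimately show ?case using A by (simp add: wf_ctx_has_type.ty_abs)
  next
    case (ty_app \<Gamma> t A B u)
    have "has_type \<Sigma> R \<Delta> (subst \<theta> t) (Pi (subst \<theta> A) (subst (up \<theta>) B))"
      using ty_app.IH(1)[OF ty_app.prems] by simp
    then show ?case
      using ty_app.IH(2)[OF ty_app.prems] by (simp add: subst_inst wf_ctx_has_type.ty_app)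
  next
    case (ty_conv \<Gamma> t A B s)
    then show ?case
      by (metis conv_subst subst.simps(3) wf_ctx_has_type.ty_conv)
  qed (auto intro: wf_ctx_has_type.intros)
qed

lemma has_type_inst:
  assumes "has_type \<Sigma> R (A # \<Gamma>) t B" and "has_type \<Sigma> R \<Gamma> u A"
  shows "has_type \<Sigma> R \<Gamma> (inst u t) (inst u B)"
  unfolding inst_def
proof (rule has_type_subst[OF assms(1)])
  show wf: "wf_ctx \<Sigma> R \<Gamma>" using assms(2) by (rule has_type_wf_ctx)
  fix i assume i: "i < length (A # \<Gamma>)"
  show "has_type \<Sigma> R \<Gamma> (case_nat u Var i) (subst (case_nat u Var) (lookup (A # \<Gamma>) i))"
  proof (cases i)
    case 0
    then show ?thesis using assms(2) by (simp add: subst_rename)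
  next
    case (Suc j)
    then have "has_type \<Sigma> R \<Gamma> (Var j) (lookup \<Gamma> j)" using i wf by (intro ty_var) auto
    then show ?thesis unfolding Suc lookup_Cons_Suc by (simp add: rename_eq_subst subst_subst)
  qed
qed

text \<open>The identity substitution is well typed between the two contexts; only variable 0
  requires a conversion.\<close>

lemma has_type_ctx_conv:
  assumes "has_type \<Sigma> R (A # \<Gamma>) t B" and "has_type \<Sigma> R \<Gamma> A' (Sort s)" and "conv R A' A"
  shows "has_type \<Sigma> R (A' # \<Gamma>) t B"
proof -
  have wf: "wf_ctx \<Sigma> R (A' # \<Gamma>)" using assms(2) by (rule wf_decl)
  have "has_type \<Sigma> R (A' # \<Gamma>) (Var i) (lookup (A # \<Gamma>) i)" if "i < length (A # \<Gamma>)" for i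
  proof (cases i)
    case 0
    \<comment> \<open>The target of the conversion must be sorted; this comes from well-formedness
      of the original context.\<close>
    obtain s' where "has_type \<Sigma> R \<Gamma> A (Sort s')"
      using assms(1) has_type_wf_ctx wf_ctx_ConsE by blast
    then have "has_type \<Sigma> R (A' # \<Gamma>) (rename Suc A) (Sort s')"
      using has_type_weaken[OF _ wf] by fastforce
    moreover have "has_type \<Sigma> R (A' # \<Gamma>) (Var 0) (rename Suc A')"
      using ty_var[OF wf, of 0] by simp
    ultimately show ?thesis using 0 conv_rename[OF assms(3)] by (auto intro: ty_conv)
  next
    case (Suc j)
    then show ?thesis using ty_var[OF wf, of i] that by simp
  qed
  then show ?thesis using has_type_subst[OF assms(1) wf, of Var] by simp
qed

section \<open>Well-sortedness of types\<close>

lemma lookup_typed: "wf_ctx \<Sigma> R \<Gamma> \<Longrightarrow> i < length \<Gamma> \<Longrightarrow> \<exists>s. has_type \<Sigma> R \<Gamma> (lookup \<Gamma> i) (Sort s)"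
proof (induction \<Gamma> arbitrary: i)
  case (Cons A \<Gamma>)
  obtain s where A: "has_type \<Sigma> R \<Gamma> A (Sort s)" using Cons.prems(1) by (rule wf_ctx_ConsE)
  have lift: "has_type \<Sigma> R (A # \<Gamma>) (rename Suc B) (Sort s')" if "has_type \<Sigma> R \<Gamma> B (Sort s')" for B s'
    using has_type_weaken[OF that Cons.prems(1)] by simp
  show ?case
  proof (cases i)
    case 0
    then show ?thesis using lift[OF A] by auto
  next
    case (Suc j)
    then show ?thesis
      using Cons.IH[of j] Cons.prems(2) has_type_wf_ctx[OF A] lift
      unfolding Suc lookup_Cons_Suc by auto
  qed
qed simp

text \<open>The exception is unavoidable: \<open>ty_sort\<close> yields \<open>Sort Kind\<close> as
  a type, and \<open>Sort Kind\<close> itself has no type.\<close>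

lemma type_sorted: "has_type \<Sigma> R \<Gamma> t A \<Longrightarrow> A = Sort Kind \<or> (\<exists>s. has_type \<Sigma> R \<Gamma> A (Sort s))"
proof (induction rule: wf_ctx_has_type.inducts(2)[where ?P1.0 = "\<lambda>_. True"])
  case (ty_const \<Gamma> A s c)
  then show ?case
    \<comment> \<open>From the empty context every renaming is admissible, and the closed type
      \<open>A\<close> is unchanged by it.\<close>
    using has_type_rename[of "[]" A "Sort s" \<Gamma> id] by (auto simp: rename_closed[OF sig_closed])
next
  case (ty_var \<Gamma> i)
  then show ?case using lookup_typed by blast
next
  case (ty_prod \<Gamma> A B s)
  then show ?case by (cases s) (auto intro: ty_sort has_type_wf_ctx)
next
  case (ty_abs \<Gamma> A B s t)
  then show ?case by (auto intro: wf_ctx_has_type.ty_prod)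
next
  case (ty_app \<Gamma> t A B u)
  \<comment> \<open>A product is not \<open>Sort Kind\<close>, so the induction hypothesis types it,
    and generation gives a sort for its codomain.\<close>
  then obtain s where "has_type \<Sigma> R (A # \<Gamma>) B (Sort s)" by (auto elim: has_type_PiE)
  from has_type_inst[OF this ty_app.hyps(2)] show ?case by (auto simp: inst_def)
qed auto

lemma type_Pi_sorted:
  assumes "has_type \<Sigma> R \<Gamma> t (Pi A B)"
  obtains s where "has_type \<Sigma> R \<Gamma> A (Sort Type)" "has_type \<Sigma> R (A # \<Gamma>) B (Sort s)"
  using type_sorted[OF assms] by (auto elim: has_type_PiE)

end

section \<open>Confluent systems\<close>

locale confluent_lp_system =
  fixes \<Sigma> :: "'c signature" and R :: "'c rule set"
  assumes confluent: "confluent_system \<Sigma> R"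
begin

sublocale lp_system
  using confluent by unfold_locales (simp add: confluent_system_def)

lemma confluence:
  assumes "t \<in> Lambda \<Sigma>" "(red R)\<^sup>*\<^sup>* t u" "(red R)\<^sup>*\<^sup>* t v"
  obtains w where "(red R)\<^sup>*\<^sup>* u w" "(red R)\<^sup>*\<^sup>* v w"
  using assms confluent unfolding confluent_system_def beta_rew_eq_red by blast

text \<open>
  A conversion between terms over \<open>\<Sigma>\<close> may pass through terms with other constants, where
  confluence is not assumed; erasing these constants brings it back into \<open>\<Lambda>(\<Sigma>)\<close>.
\<close>

lemma church_rosser:
  assumes "conv R t u" "t \<in> Lambda \<Sigma>" "u \<in> Lambda \<Sigma>"
  obtains w where "(red R)\<^sup>*\<^sup>* t w" "(red R)\<^sup>*\<^sup>* u w"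
proof -
  let ?e = "erase (sig_consts \<Sigma>)"
  have L: "?e t \<in> Lambda \<Sigma>" for t by (simp add: Lambda_def const_of_erase)
  have red: "red R (?e t) (?e u)" if "red R t u" for t u
    using that rule_const by (rule red_erase)
  have "\<exists>w. (red R)\<^sup>*\<^sup>* (?e t) w \<and> (red R)\<^sup>*\<^sup>* (?e u) w"
    using assms(1) unfolding conv_def beta_rew_eq_red
  proof (induction rule: equivclp_induct)
    case (step u v)
    then obtain w where w: "(red R)\<^sup>*\<^sup>* (?e t) w" "(red R)\<^sup>*\<^sup>* (?e u) w" by blast
    from step(2) show ?case
    proof
      \<comment> \<open>A forward step is closed by confluence from the erased \<open>u\<close>; a
        backward step is merely prepended.\<close>
      assume "red R u v"
      with red have "(red R)\<^sup>*\<^sup>* (?e u) (?e v)" by blast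
      then obtain w' where "(red R)\<^sup>*\<^sup>* w w'" "(red R)\<^sup>*\<^sup>* (?e v) w'"
        using confluence[OF L w(2)] by blast
      with w(1) show ?thesis by (meson rtranclp_trans)
    next
      assume "red R v u"
      with red w show ?thesis by (meson converse_rtranclp_into_rtranclp)
    qed
  qed blast
  moreover have "?e t = t" "?e u = u" using assms(2,3) by (auto simp: Lambda_def erase_id)
  ultimately show thesis using that by auto
qed

text \<open>The common reduct is again a product, and its components are common reducts of the
  components.\<close>

lemma conv_PiD:
  assumes "conv R (Pi A B) (Pi A' B')" "Pi A B \<in> Lambda \<Sigma>" "Pi A' B' \<in> Lambda \<Sigma>"
  shows "conv R A A' \<and> conv R B B'"
proof -
  obtain C where "(red R)\<^sup>*\<^sup>* (Pi A B) C" "(red R)\<^sup>*\<^sup>* (Pi A' B') C"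
    using church_rosser assms by blast
  then show ?thesis by (auto dest!: reds_PiD) (meson conv_sym conv_trans reds_imp_conv)+
qed

section \<open>Subject reduction\<close>

text \<open>The abstraction was typed with its own domain and codomain, which injectivity of
  products relates to \<open>A\<close> and \<open>B\<close>; conversion then adjusts the argument
  before substitution and the type after it.\<close>

lemma beta_redex_typing:
  assumes "has_type \<Sigma> R \<Gamma> (Lam A0 t) (Pi A B)" and "has_type \<Sigma> R \<Gamma> u A"
  shows "has_type \<Sigma> R \<Gamma> (inst u t) (inst u B)"
proof -
  obtain B0 where A0: "has_type \<Sigma> R \<Gamma> A0 (Sort Type)"
    and t: "has_type \<Sigma> R (A0 # \<Gamma>) t B0" and conv: "conv R (Pi A0 B0) (Pi A B)"
    using assms(1) by (blast elim: has_type_LamE)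
  have "Pi A0 B0 \<in> Lambda \<Sigma>" "Pi A B \<in> Lambda \<Sigma>"
    using has_type_in_Lambda[OF A0] has_type_in_Lambda[OF t] has_type_in_Lambda[OF assms(1)] by auto
  then have AB: "conv R A0 A" "conv R B0 B" using conv_PiD conv by blast+
  have "has_type \<Sigma> R \<Gamma> u A0" using assms(2) A0 conv_sym[OF AB(1)] by (rule ty_conv)
  with t have t': "has_type \<Sigma> R \<Gamma> (inst u t) (inst u B0)" by (rule has_type_inst)
  obtain s' where "has_type \<Sigma> R (A # \<Gamma>) B (Sort s')" using assms(1) by (rule type_Pi_sorted)
  from has_type_inst[OF this assms(2)] have "has_type \<Sigma> R \<Gamma> (inst u B) (Sort s')"
    by (simp add: inst_def)
  with t' show ?thesis using conv_inst[OF AB(2)] by (rule ty_conv)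
qed

lemma rule_typing:
  assumes "rule_preserves_typing \<Sigma> R (l, r)" "(l, r) \<in> R" "has_type \<Sigma> R \<Gamma> (subst \<theta> l) A"
  shows "has_type \<Sigma> R \<Gamma> (subst \<theta> r) A"
proof -
  text \<open>Typing only bounds the constants of \<open>\<theta>\<close> on the variables of \<open>l\<close>.\<close>
  define \<theta>' where "\<theta>' i = (if i \<in> fv l then \<theta> i else Var i)" for i
  have l: "subst \<theta>' l = subst \<theta> l" by (rule subst_cong_fv) (simp add: \<theta>'_def)
  have r: "subst \<theta>' r = subst \<theta> r"
    by (rule subst_cong_fv) (use rule_fv[OF assms(2)] in \<open>auto simp: \<theta>'_def\<close>)
  have L: "ctx_in \<Gamma> \<Sigma>" "subst \<theta> l \<in> Lambda \<Sigma>" "A \<in> Lambda \<Sigma>"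
    using has_type_in_Lambda[OF assms(3)] by auto
  then have "range \<theta>' \<subseteq> Lambda \<Sigma>"
    by (auto simp: \<theta>'_def Lambda_def const_of_subst split: if_splits)
  then have "has_type \<Sigma> R \<Gamma> (subst \<theta>' r) A"
    using assms(1,3) L by (auto simp: rule_preserves_typing_def l)
  then show ?thesis by (simp add: r)
qed

text \<open>By induction on typing. A reduced domain is absorbed by converting the context, a
  reduced argument by converting the type of the application.\<close>

lemma subject_reduction:
  assumes "preserves_typing \<Sigma> R" "has_type \<Sigma> R \<Gamma> t A" "red R t t'"
  shows "has_type \<Sigma> R \<Gamma> t' A"
proof -
  have rule: "has_type \<Sigma> R \<Gamma> (subst \<theta> r) A"
    if "(l, r) \<in> R" "has_type \<Sigma> R \<Gamma> (subst \<theta> l) A" for l r \<theta> \<Gamma> A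
    using rule_typing that assms(1) by (auto simp: preserves_typing_def)
  show ?thesis using assms(2,3)
  proof (induction arbitrary: t' rule: wf_ctx_has_type.inducts(2)[where ?P1.0 = "\<lambda>_. True"])
    case (ty_sort \<Gamma>)
    then show ?case by (simp add: not_red_Sort)
  next
    case (ty_const \<Gamma> A s c)
    then have "has_type \<Sigma> R \<Gamma> (Const c) A" by (auto intro: wf_ctx_has_type.ty_const)
    with ty_const.prems show ?case by cases (auto simp: rule)
  next
    case (ty_var \<Gamma> i)
    then show ?case by (simp add: not_red_Var)
  next
    case (ty_prod \<Gamma> A B s)
    from ty_prod.prems show ?case
    proof (cases rule: red_PiE)
      case (1 A')
      then have "has_type \<Sigma> R \<Gamma> A' (Sort Type)" using ty_prod.IH by blast
      moreover from this have "has_type \<Sigma> R (A' # \<Gamma>) B (Sort s)"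
        using has_type_ctx_conv[OF ty_prod.hyps(2)] 1 red_imp_conv conv_sym by blast
      ultimately show ?thesis unfolding 1 by (rule wf_ctx_has_type.ty_prod)
    next
      case (2 B')
      with ty_prod show ?thesis by (auto intro: wf_ctx_has_type.ty_prod)
    qed
  next
    case (ty_abs \<Gamma> A B s t)
    from ty_abs.prems show ?case
    proof (cases rule: red_LamE)
      case (1 A')
      then have A': "has_type \<Sigma> R \<Gamma> A' (Sort Type)" using ty_abs.IH by blast
      have conv: "conv R A' A" using 1 red_imp_conv conv_sym by blast
      have "has_type \<Sigma> R \<Gamma> (Lam A' t) (Pi A' B)"
        using A' has_type_ctx_conv[OF ty_abs.hyps(2) A' conv] has_type_ctx_conv[OF ty_abs.hyps(3) A' conv]
        by (rule wf_ctx_has_type.ty_abs)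
      \<comment> \<open>Converting back to the original type requires that type to be
        sorted.\<close>
      moreover have "has_type \<Sigma> R \<Gamma> (Pi A B) (Sort s)"
        using ty_abs.hyps by (blast intro: wf_ctx_has_type.ty_prod)
      moreover have "conv R (Pi A' B) (Pi A B)"
        using 1 by (blast intro: conv_sym red_imp_conv red_Pi1)
      ultimately show ?thesis unfolding 1 by (rule ty_conv)
    next
      case (2 B')
      with ty_abs show ?thesis by (auto intro: wf_ctx_has_type.ty_abs)
    qed
  next
    case (ty_app \<Gamma> t A B u)
    have app: "has_type \<Sigma> R \<Gamma> (App t u) (inst u B)"
      using ty_app.hyps by (rule wf_ctx_has_type.ty_app)
    from ty_app.prems show ?case
    proof cases
      case (red_beta A0 t0)
      then show ?thesis using ty_app.hyps beta_redex_typing by auto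
    next
      case (red_rule l r \<theta>)
      with app show ?thesis by (simp add: rule)
    next
      case (red_App1 t0)
      then show ?thesis using ty_app by (auto intro: wf_ctx_has_type.ty_app)
    next
      case (red_App2 u')
      then have "has_type \<Sigma> R \<Gamma> (App t u') (inst u' B)"
        using ty_app by (auto intro: wf_ctx_has_type.ty_app)
      \<comment> \<open>The new type is \<open>inst u' B\<close>; returning to
        \<open>inst u B\<close> requires a sort for the latter.\<close>
      moreover obtain s where "has_type \<Sigma> R (A # \<Gamma>) B (Sort s)"
        using ty_app.hyps(1) by (rule type_Pi_sorted)
      from has_type_inst[OF this ty_app.hyps(2)] have "has_type \<Sigma> R \<Gamma> (inst u B) (Sort s)"
        by (simp add: inst_def)
      moreover have "conv R (inst u' B) (inst u B)"
        using red_App2 by (intro conv_sym[OF reds_imp_conv] reds_inst_arg) auto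
      ultimately show ?thesis unfolding red_App2 by (rule ty_conv)
    qed
  next
    case (ty_conv \<Gamma> t A B s)
    then show ?case by (blast intro: wf_ctx_has_type.ty_conv)
  qed auto
qed

lemma subject_reductions:
  assumes "preserves_typing \<Sigma> R" "(red R)\<^sup>*\<^sup>* t t'" "has_type \<Sigma> R \<Gamma> t A"
  shows "has_type \<Sigma> R \<Gamma> t' A"
  using assms(2,3) by (induction rule: rtranclp_induct) (auto intro: subject_reduction[OF assms(1)])

end

section \<open>Fragments\<close>

locale lp_fragment = confluent_lp_system \<Sigma>0 R0
  for \<Sigma>0 :: "'c signature" and R0 :: "'c rule set" +
  fixes \<Sigma>1 :: "'c signature" and R1 :: "'c rule set"
  assumes fragment: "fragment \<Sigma>1 R1 \<Sigma>0 R0"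
begin

text \<open>The closure condition on rules turns common reducts found in the large system into
  common reducts within the fragment.\<close>

lemma fragment_reds:
  assumes "(red R0)\<^sup>*\<^sup>* t t'" "t \<in> Lambda \<Sigma>1"
  shows "t' \<in> Lambda \<Sigma>1 \<and> (red R1)\<^sup>*\<^sup>* t t'"
proof -
  have "const_of r \<subseteq> sig_consts \<Sigma>1 \<and> (l, r) \<in> R1"
    if "(l, r) \<in> R0" "const_of l \<subseteq> sig_consts \<Sigma>1" for l r
    using that fragment by (auto simp: fragment_def)
  from reds_restrict[OF assms(1) _ this rule_fv] show ?thesis
    using assms(2) by (simp add: Lambda_def)
qed

lemma red_fragment_mono: "(red R1)\<^sup>*\<^sup>* t t' \<Longrightarrow> (red R0)\<^sup>*\<^sup>* t t'"
proof -
  have "red R0 t t'" if "red R1 t t'" for t t' :: "'c trm"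
    using that fragment by induction (auto simp: fragment_def intro: red.intros)
  then show "(red R1)\<^sup>*\<^sup>* t t' \<Longrightarrow> (red R0)\<^sup>*\<^sup>* t t'" by (metis mono_rtranclp)
qed

lemma Lambda_fragment_mono: "Lambda \<Sigma>1 \<subseteq> Lambda \<Sigma>0"
proof -
  have "sig_consts \<Sigma>1 \<subseteq> sig_consts \<Sigma>0"
    using fragment unfolding fragment_def sig_consts_def by (intro image_mono) simp
  then show ?thesis by (auto simp: Lambda_def)
qed

text \<open>A peak over \<open>\<Sigma>1\<close> is joined in the large system, and the joining
  reductions start over \<open>\<Sigma>1\<close>, so they are reductions of the fragment.\<close>

sublocale frag: confluent_lp_system \<Sigma>1 R1
proof
  show "confluent_system \<Sigma>1 R1"
    unfolding confluent_system_def beta_rew_eq_red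
  proof (intro conjI allI impI)
    show "system \<Sigma>1 R1" using fragment by (simp add: fragment_def)
    fix t u v assume t: "t \<in> Lambda \<Sigma>1" and "(red R1)\<^sup>*\<^sup>* t u" "(red R1)\<^sup>*\<^sup>* t v"
    then have uv: "(red R0)\<^sup>*\<^sup>* t u" "(red R0)\<^sup>*\<^sup>* t v" by (auto intro: red_fragment_mono)
    moreover have "t \<in> Lambda \<Sigma>0" using t Lambda_fragment_mono by blast
    ultimately obtain w where "(red R0)\<^sup>*\<^sup>* u w" "(red R0)\<^sup>*\<^sup>* v w" using confluence by blast
    moreover have "u \<in> Lambda \<Sigma>1" "v \<in> Lambda \<Sigma>1" using uv t fragment_reds by blast+
    ultimately show "\<exists>w. (red R1)\<^sup>*\<^sup>* u w \<and> (red R1)\<^sup>*\<^sup>* v w" using fragment_reds by blast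
  qed
qed

text \<open>The fragment's declaration of \<open>c\<close> is also one of \<open>\<Sigma>0\<close>,
  where \<open>c\<close> is declared only once.\<close>

lemma fragment_decl:
  assumes "(c, A) \<in> set \<Sigma>0" "c \<in> sig_consts \<Sigma>1"
  shows "(c, A) \<in> set \<Sigma>1" "A \<in> Lambda \<Sigma>1"
proof -
  obtain A' where "(c, A') \<in> set \<Sigma>1" using assms(2) by (auto simp: sig_consts_def)
  moreover from this have "(c, A') \<in> set \<Sigma>0" using fragment by (auto simp: fragment_def)
  then have "A' = A"
    using assms(1) system by (auto simp: system_def is_signature_def dest: eq_key_imp_eq_value)
  ultimately show "(c, A) \<in> set \<Sigma>1" by simp
  then show "A \<in> Lambda \<Sigma>1" using fragment by (auto simp: fragment_def Lambda_def)
qed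

text \<open>A reduct of \<open>D\<close> is sought because conversion in the large system can give a
  term over the fragment a type with foreign constants.\<close>

lemma fragment_typing:
  assumes "no_new_Kind R0" and pres: "preserves_typing \<Sigma>1 R1"
  shows "wf_ctx \<Sigma>0 R0 \<Gamma> \<Longrightarrow> ctx_in \<Gamma> \<Sigma>1 \<Longrightarrow> wf_ctx \<Sigma>1 R1 \<Gamma>"
    and "has_type \<Sigma>0 R0 \<Gamma> t D \<Longrightarrow> ctx_in \<Gamma> \<Sigma>1 \<Longrightarrow> t \<in> Lambda \<Sigma>1 \<Longrightarrow>
      \<exists>D' \<in> Lambda \<Sigma>1. (red R0)\<^sup>*\<^sup>* D D' \<and> has_type \<Sigma>1 R1 \<Gamma> t D'"
proof (induction rule: wf_ctx_has_type.inducts)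
  case wf_empty
  show ?case by (rule wf_ctx_has_type.wf_empty)
next
  case (wf_decl \<Gamma> A s)
  then show ?case by (auto simp: ctx_in_def dest: reds_SortD intro: wf_ctx_has_type.wf_decl)
next
  case (ty_sort \<Gamma>)
  then show ?case by (auto intro!: bexI[of _ "Sort Kind"] wf_ctx_has_type.ty_sort)
next
  case (ty_const \<Gamma> A s c)
  then have A: "(c, A) \<in> set \<Sigma>1" "A \<in> Lambda \<Sigma>1" using fragment_decl by simp_all
  then have "has_type \<Sigma>1 R1 [] A (Sort s)"
    using ty_const by (auto simp: ctx_in_def dest: reds_SortD)
  with A ty_const show ?case by (auto intro!: bexI[of _ A] wf_ctx_has_type.ty_const)
next
  case (ty_var \<Gamma> i)
  then have "lookup \<Gamma> i \<in> Lambda \<Sigma>1" by (auto simp: ctx_in_def)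
  with ty_var show ?case by (blast intro: wf_ctx_has_type.ty_var)
next
  case (ty_prod \<Gamma> A B s)
  then have "has_type \<Sigma>1 R1 \<Gamma> A (Sort Type)" "has_type \<Sigma>1 R1 (A # \<Gamma>) B (Sort s)"
    by (auto simp: ctx_in_def dest: reds_SortD)
  then show ?case by (auto intro!: bexI[of _ "Sort s"] wf_ctx_has_type.ty_prod)
next
  case (ty_abs \<Gamma> A B s t)
  then have A: "has_type \<Sigma>1 R1 \<Gamma> A (Sort Type)" by (auto dest: reds_SortD)
  have L: "ctx_in (A # \<Gamma>) \<Sigma>1" "A \<in> Lambda \<Sigma>1" "t \<in> Lambda \<Sigma>1"
    using ty_abs.prems by (auto simp: ctx_in_def)
  obtain B' where B': "B' \<in> Lambda \<Sigma>1" "(red R0)\<^sup>*\<^sup>* B B'" "has_type \<Sigma>1 R1 (A # \<Gamma>) t B'"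
    using ty_abs.IH(6)[OF L(1,3)] by blast
  \<comment> \<open>\<open>B\<close> is the subject of a premise, so it contains no
    \<open>Kind\<close>; this excludes the exceptional case of \<open>type_sorted\<close> for
    \<open>B'\<close>.\<close>
  have "Kind \<notin> sorts_of B'"
    using assms(1) B'(2) has_type_subject_Kind[OF ty_abs.IH(3)] by (rule reds_no_new_Kind)
  then obtain s' where "has_type \<Sigma>1 R1 (A # \<Gamma>) B' (Sort s')"
    using frag.type_sorted[OF B'(3)] by auto
  with A B' have "has_type \<Sigma>1 R1 \<Gamma> (Lam A t) (Pi A B')" by (blast intro: wf_ctx_has_type.ty_abs)
  moreover have "(red R0)\<^sup>*\<^sup>* (Pi A B) (Pi A B')" using B'(2) by (simp add: reds_Pi)
  ultimately show ?case using L B' by (intro bexI[of _ "Pi A B'"]) auto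
next
  case (ty_app \<Gamma> t A B u)
  then obtain C A2 where C: "C \<in> Lambda \<Sigma>1" "(red R0)\<^sup>*\<^sup>* (Pi A B) C" "has_type \<Sigma>1 R1 \<Gamma> t C"
    and A2: "A2 \<in> Lambda \<Sigma>1" "(red R0)\<^sup>*\<^sup>* A A2" "has_type \<Sigma>1 R1 \<Gamma> u A2"
    by auto
  obtain A1 B1 where [simp]: "C = Pi A1 B1"
    and A1: "(red R0)\<^sup>*\<^sup>* A A1" and B1: "(red R0)\<^sup>*\<^sup>* B B1"
    using reds_PiD[OF C(2)] by blast
  have L: "A1 \<in> Lambda \<Sigma>1" "B1 \<in> Lambda \<Sigma>1" using C(1) by auto
  \<comment> \<open>The domain \<open>A1\<close> in the type of \<open>t\<close> and the type
    \<open>A2\<close> of \<open>u\<close> are reducts of the same \<open>A\<close>, so confluence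
    joins them.\<close>
  have "A \<in> Lambda \<Sigma>0" using has_type_in_Lambda[OF ty_app.IH(3)] by blast
  then obtain A3 where "(red R0)\<^sup>*\<^sup>* A1 A3" "(red R0)\<^sup>*\<^sup>* A2 A3" using confluence A1 A2(2) by blast
  then have "(red R1)\<^sup>*\<^sup>* A1 A3" "(red R1)\<^sup>*\<^sup>* A2 A3" using fragment_reds L A2(1) by blast+
  then have "conv R1 A2 A1" by (meson conv_sym conv_trans reds_imp_conv)
  moreover have "has_type \<Sigma>1 R1 \<Gamma> A1 (Sort Type)" using C(3) frag.type_Pi_sorted by auto
  ultimately have "has_type \<Sigma>1 R1 \<Gamma> u A1" using A2(3) by (blast intro: ty_conv)
  then have "has_type \<Sigma>1 R1 \<Gamma> (App t u) (inst u B1)"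
    using C(3) by (auto intro: wf_ctx_has_type.ty_app)
  moreover have "inst u B1 \<in> Lambda \<Sigma>1" using L ty_app.prems by (simp add: inst_in_Lambda)
  ultimately show ?case using reds_inst[OF B1] by blast
next
  case (ty_conv \<Gamma> t A B s)
  then obtain A' where A': "A' \<in> Lambda \<Sigma>1" "(red R0)\<^sup>*\<^sup>* A A'" "has_type \<Sigma>1 R1 \<Gamma> t A'" by blast
  have L: "A \<in> Lambda \<Sigma>0" "B \<in> Lambda \<Sigma>0"
    using has_type_in_Lambda[OF ty_conv.IH(1)] has_type_in_Lambda[OF ty_conv.IH(3)] by auto
  \<comment> \<open>\<open>A\<close> and \<open>B\<close> may leave the fragment, so they are joined
    at \<open>C\<close> in the large system; joining \<open>A'\<close> with \<open>C\<close> gives a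
    reduct \<open>E\<close> of \<open>B\<close> that is reached from the fragment.\<close>
  obtain C where C: "(red R0)\<^sup>*\<^sup>* A C" "(red R0)\<^sup>*\<^sup>* B C" using church_rosser ty_conv.IH(5) L by blast
  obtain E where E: "(red R0)\<^sup>*\<^sup>* A' E" "(red R0)\<^sup>*\<^sup>* C E" using confluence[OF L(1) A'(2) C(1)] .
  have BE: "(red R0)\<^sup>*\<^sup>* B E" using C(2) E(2) by (rule rtranclp_trans)
  have E1: "E \<in> Lambda \<Sigma>1" "(red R1)\<^sup>*\<^sup>* A' E" using fragment_reds[OF E(1) A'(1)] by auto
  have "has_type \<Sigma>1 R1 \<Gamma> t E"
  proof (cases "A' = Sort Kind")
    case True
    \<comment> \<open>\<open>Sort Kind\<close> has no sort to carry along, but it is normal, so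
      \<open>E\<close> equals \<open>A'\<close>.\<close>
    then show ?thesis using A'(3) reds_SortD E(1) by auto
  next
    case False
    then obtain s' where "has_type \<Sigma>1 R1 \<Gamma> A' (Sort s')" using frag.type_sorted[OF A'(3)] by blast
    \<comment> \<open>Subject reduction is applied to the type \<open>A'\<close> as a subject,
      making \<open>E\<close> a legal target of conversion.\<close>
    with pres E1(2) have "has_type \<Sigma>1 R1 \<Gamma> E (Sort s')" by (rule frag.subject_reductions)
    with A'(3) show ?thesis using reds_imp_conv[OF E1(2)] by (rule wf_ctx_has_type.ty_conv)
  qed
  with E1(1) BE show ?case by blast
qed

end

theorem theorem4p5:
  fixes \<Sigma>0 \<Sigma>1 :: "'c signature" and R0 R1 :: "'c rule set"
  assumes "confluent_system \<Sigma>0 R0"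
    and "no_new_Kind R0"
    and "fragment \<Sigma>1 R1 \<Sigma>0 R0"
    and "preserves_typing \<Sigma>1 R1"
  shows "(\<forall>\<Gamma> t D. has_type \<Sigma>0 R0 \<Gamma> t D \<longrightarrow> ctx_in \<Gamma> \<Sigma>1 \<longrightarrow> t \<in> Lambda \<Sigma>1 \<longrightarrow>
            (\<exists>D' \<in> Lambda \<Sigma>1. (beta_rew R0)\<^sup>*\<^sup>* D D' \<and> has_type \<Sigma>1 R1 \<Gamma> t D')) \<and>
         (\<forall>\<Gamma>. wf_ctx \<Sigma>0 R0 \<Gamma> \<longrightarrow> ctx_in \<Gamma> \<Sigma>1 \<longrightarrow> wf_ctx \<Sigma>1 R1 \<Gamma>)"
proof -
  interpret lp_fragment \<Sigma>0 R0 \<Sigma>1 R1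
    by unfold_locales (fact assms)+
  show ?thesis
    using fragment_typing[OF assms(2,4)] unfolding beta_rew_eq_red by blast
qed

end
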